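(* Let $\Omega=B(0,1)\subset\mathbb{R}^2$ be the Euclidean unit disc, and let $\phi$ be a metric integrand depending only on the second variable such that $B_\phi(0,1)$ is not strictly convex. Then there exist boundary data $f\in C^\infty(\partial\Omega)$ such that the solution to the anisotropic least gradient problem $$\min\Big\{\int_\Omega\phi(Du):\ u\in BV(\Omega),\ u|_{\partial\Omega}=f\Big\}$$ is not unique.
   Context: A metric integrand depending only on the second variable is a convex function $\phi:\mathbb{R}^2\to[0,\infty)$ with $\phi(t\xi)=|t|\phi(\xi)$ for $t\in\mathbb{R}$ and $\lambda|\xi|\le\phi(\xi)\le\Gamma|\xi|$ for some constants $\lambda,\Gamma>0$ (i.e. a norm). $B_\phi(0,1)$ is its unit ball; not strictly convex means that $\partial B_\phi(0,1)$ contains a nondegenerate line segment. With $\phi^0(\xi^* )=\sup\{\langle\xi^*,\xi\rangle:\phi(\xi)\le1\}$, the $\phi$-total variation is $$\int_\Omega\phi(Du)=\int_\Omega|Du|_\phi=\sup\Big\{\int_\Omega u\,\mathrm{div}\,\mathbf{z}\,dx:\ \mathbf{z}\in C_c^1(\Omega;\mathbb{R}^2),\ \phi^0(\mathbf{z}(x))\le1\ \text{a.e.}\Big\}.$$ A function $u\in BV(\Omega)$ is of $\phi$-least gradient if $\int_\Omega|Du|_\phi\le\int_\Omega|D(u+v)|_\phi$ for every compactly supported $v\in BV(\Omega)$ (equivalently here, for every $v\in BV(\Omega)$ with zero trace). A solution to the problem is a function $u$ of $\phi$-least gradient with trace $Tu=f$. Functions are identified if they agree a.e. *)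

theory Defs
  imports "HOL-Analysis.Analysis"
begin

subsection \<open>Metric integrands\<close>

definition metric_integrand :: "('a::euclidean_space \<Rightarrow> real) \<Rightarrow> bool" where
  "metric_integrand \<phi> \<longleftrightarrow>
     convex_on UNIV \<phi> \<and>
     (\<forall>\<xi>. 0 \<le> \<phi> \<xi>) \<and>
     (\<forall>t \<xi>. \<phi> (t *\<^sub>R \<xi>) = \<bar>t\<bar> * \<phi> \<xi>) \<and>
     (\<exists>\<gamma>>0. \<exists>\<Gamma>>0. \<forall>\<xi>. \<gamma> * norm \<xi> \<le> \<phi> \<xi> \<and> \<phi> \<xi> \<le> \<Gamma> * norm \<xi>)"

definition integrand_ball :: "('a::euclidean_space \<Rightarrow> real) \<Rightarrow> 'a set" where
  "integrand_ball \<phi> = {\<xi>. \<phi> \<xi> \<le> 1}"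

definition strictly_convex_body :: "'a::euclidean_space set \<Rightarrow> bool" where
  "strictly_convex_body B \<longleftrightarrow> \<not> (\<exists>a b. a \<noteq> b \<and> closed_segment a b \<subseteq> frontier B)"

definition polar_integrand :: "('a::euclidean_space \<Rightarrow> real) \<Rightarrow> 'a \<Rightarrow> real" where
  "polar_integrand \<phi> \<eta> = (SUP \<xi>\<in>{\<xi>. \<phi> \<xi> \<le> 1}. \<eta> \<bullet> \<xi>)"


subsection \<open>Total variation and functions of bounded variation\<close>

text \<open>Test fields are extended by zero outside \<open>\<Omega>\<close>.\<close>

definition C1_compact_support :: "'a::euclidean_space set \<Rightarrow> ('a \<Rightarrow> 'a) \<Rightarrow> bool" where
  "C1_compact_support \<Omega> z \<longleftrightarrow>
     (\<exists>z'. (\<forall>x\<in>\<Omega>. (z has_derivative blinfun_apply (z' x)) (at x)) \<and> continuous_on \<Omega> z') \<and>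
     (\<exists>K. compact K \<and> K \<subseteq> \<Omega> \<and> (\<forall>x. x \<notin> K \<longrightarrow> z x = 0))"

definition divergence :: "('a::euclidean_space \<Rightarrow> 'a) \<Rightarrow> 'a \<Rightarrow> real" where
  "divergence z x = (\<Sum>b\<in>Basis. frechet_derivative z (at x) b \<bullet> b)"

definition total_variation :: "'a::euclidean_space set \<Rightarrow> ('a \<Rightarrow> real) \<Rightarrow> ereal" where
  "total_variation \<Omega> u =
     (SUP z\<in>{z. C1_compact_support \<Omega> z \<and> (\<forall>x\<in>\<Omega>. norm (z x) \<le> 1)}.
        ereal (\<integral>x. u x * divergence z x \<partial>lebesgue_on \<Omega>))"

definition anisotropic_variation ::
    "('a::euclidean_space \<Rightarrow> real) \<Rightarrow> 'a set \<Rightarrow> ('a \<Rightarrow> real) \<Rightarrow> ereal" where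
  "anisotropic_variation \<phi> \<Omega> u =
     (SUP z\<in>{z. C1_compact_support \<Omega> z \<and> (AE x in lebesgue_on \<Omega>. polar_integrand \<phi> (z x) \<le> 1)}.
        ereal (\<integral>x. u x * divergence z x \<partial>lebesgue_on \<Omega>))"

text \<open>Elements of \<open>BV(\<Omega>)\<close> are represented by total functions; only their values
  almost everywhere on \<open>\<Omega>\<close> matter.\<close>

definition BV :: "'a::euclidean_space set \<Rightarrow> ('a \<Rightarrow> real) set" where
  "BV \<Omega> = {u. integrable (lebesgue_on \<Omega>) u \<and> total_variation \<Omega> u < \<infinity>}"

definition compactly_supported_in :: "'a::euclidean_space set \<Rightarrow> ('a \<Rightarrow> real) \<Rightarrow> bool" where
  "compactly_supported_in \<Omega> v \<longleftrightarrow>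
     (\<exists>K. compact K \<and> K \<subseteq> \<Omega> \<and> (AE x in lebesgue_on \<Omega>. x \<notin> K \<longrightarrow> v x = 0))"

definition least_gradient ::
    "('a::euclidean_space \<Rightarrow> real) \<Rightarrow> 'a set \<Rightarrow> ('a \<Rightarrow> real) \<Rightarrow> bool" where
  "least_gradient \<phi> \<Omega> u \<longleftrightarrow>
     u \<in> BV \<Omega> \<and>
     (\<forall>v\<in>BV \<Omega>. compactly_supported_in \<Omega> v \<longrightarrow>
        anisotropic_variation \<phi> \<Omega> u \<le> anisotropic_variation \<phi> \<Omega> (\<lambda>x. u x + v x))"


subsection \<open>Boundary data on the unit circle\<close>

abbreviation unit_disc :: "(real^2) set" where
  "unit_disc \<equiv> ball 0 1"

definition circle_point :: "real \<Rightarrow> real^2" where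
  "circle_point \<theta> = vector [cos \<theta>, sin \<theta>]"

text \<open>One-dimensional Hausdorff measure on the unit circle, as the image of Lebesgue measure
  under the arc-length parametrization.\<close>

definition circle_measure :: "(real^2) measure" where
  "circle_measure = distr (restrict_space lborel {0..<2 * pi}) borel circle_point"

text \<open>\<^term>\<open>distr\<close> is only meaningful for measurable maps.\<close>

lemma circle_point_measurable: "circle_point \<in> measurable (restrict_space lborel {0..<2 * pi}) borel"
proof -
  have "circle_point = (\<lambda>\<theta>. \<chi> i. if i = 1 then cos \<theta> else sin \<theta>)"
    by (simp add: fun_eq_iff circle_point_def vec_eq_iff forall_2)
  moreover have "continuous_on UNIV (\<lambda>\<theta>::real. (\<chi> i. if i = 1 then cos \<theta> else sin \<theta>) :: real^2)"
  proof (rule continuous_on_vec_lambda)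
    fix i :: 2
    show "continuous_on UNIV (\<lambda>\<theta>::real. if i = 1 then cos \<theta> else sin \<theta>)"
      by (cases "i = 1") (simp_all add: continuous_on_cos continuous_on_sin)
  qed
  ultimately have "continuous_on UNIV circle_point" by (simp only:)
  then have "circle_point \<in> borel_measurable borel"
    by (rule borel_measurable_continuous_onI)
  then show ?thesis
    by (intro measurable_restrict_space1) simp
qed

text \<open>Smoothness on the circle as a manifold, read in the angular coordinate. Only the values
  of \<open>f\<close> on the circle enter.\<close>

definition smooth_on_circle :: "(real^2 \<Rightarrow> real) \<Rightarrow> bool" where
  "smooth_on_circle f \<longleftrightarrow>
     (\<forall>n \<theta>. ((deriv ^^ n) (\<lambda>t. f (circle_point t))) field_differentiable at \<theta>)"

text \<open>The BV trace of \<open>u\<close> is, up to null sets, the function \<open>f\<close> on the boundary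
  such that at almost every boundary point \<open>x\<close> the mean of \<open>\<bar>u - f x\<bar>\<close> over
  \<open>\<Omega> \<inter> B(x,r)\<close> tends to zero with \<open>r\<close>.\<close>

definition has_trace_on_circle :: "(real^2 \<Rightarrow> real) \<Rightarrow> (real^2 \<Rightarrow> real) \<Rightarrow> bool" where
  "has_trace_on_circle u f \<longleftrightarrow>
     (AE x in circle_measure.
        ((\<lambda>r. (\<integral>y. \<bar>u y - f x\<bar> \<partial>lebesgue_on (unit_disc \<inter> ball x r))
              / measure lebesgue (unit_disc \<inter> ball x r)) \<longlongrightarrow> 0) (at_right 0))"

definition least_gradient_solution ::
    "(real^2 \<Rightarrow> real) \<Rightarrow> (real^2 \<Rightarrow> real) \<Rightarrow> (real^2 \<Rightarrow> real) \<Rightarrow> bool" where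
  "least_gradient_solution \<phi> f u \<longleftrightarrow>
     least_gradient \<phi> unit_disc u \<and> has_trace_on_circle u f"

end

theory Submission
  imports Defs
begin

text \<open>
  Along a segment \<open>[a, b]\<close> in the boundary of its unit ball, \<open>\<phi>\<close> is no better than a linear
  functional: there is a vector \<open>\<nu>\<close> with \<open>\<nu> \<bullet> \<xi> \<le> \<phi> \<xi>\<close> for all \<open>\<xi>\<close>, and with equality on the cone
  spanned by \<open>a\<close> and \<open>b\<close>. In the plane this cone has an interior point, for instance the midpoint
  \<open>m\<close> of the segment (lemma \<open>calibrated_ball_of_flat_segment\<close>).

  If the gradient of a \<open>C\<^sup>1\<close> function \<open>u\<close> takes its values in this cone, then
  \<open>\<integral> \<phi> (\<nabla>u) = \<integral> \<nu> \<bullet> \<nabla>u\<close>, and the right-hand side depends on the boundary values of \<open>u\<close> alone.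
  Any competitor \<open>w\<close> with the same boundary values has
  \<open>\<integral> \<phi> (Dw) \<ge> \<integral> \<nu> \<bullet> Dw = \<integral> \<nu> \<bullet> \<nabla>u\<close>. So the constant field \<open>\<nu>\<close> calibrates \<open>u\<close>, and \<open>u\<close> is of
  \<open>\<phi>\<close>-least gradient (lemma \<open>least_gradient_if_calibrated\<close>). Nothing here singles out one such
  \<open>u\<close>, because having a gradient in the interior of the cone is stable under small \<open>C\<^sup>1\<close>
  perturbations. The functions
  \<open>m \<bullet> x + \<epsilon> (1 - \<bar>x\<bar>\<^sup>2)\<close> have gradient \<open>m - 2 \<epsilon> x\<close> and the common boundary values
  \<open>m \<bullet> x\<close>, and they are all solutions as long as \<open>\<epsilon> \<ge> 0\<close> is small.
\<close>

section \<open>Integration by parts against test fields\<close>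

definition C1_gradient_on :: "'a::euclidean_space set \<Rightarrow> ('a \<Rightarrow> real) \<Rightarrow> ('a \<Rightarrow> 'a) \<Rightarrow> bool" where
  "C1_gradient_on \<Omega> u g \<longleftrightarrow>
     (\<forall>x\<in>\<Omega>. (u has_derivative (\<lambda>h. g x \<bullet> h)) (at x)) \<and> continuous_on \<Omega> g"

lemma C1_gradient_on_imp_continuous_on: "C1_gradient_on \<Omega> u g \<Longrightarrow> continuous_on \<Omega> u"
  unfolding C1_gradient_on_def
  by (meson continuous_at_imp_continuous_on has_derivative_continuous)

lemma has_derivative_zero_off_support:
  fixes f :: "'a::real_normed_vector \<Rightarrow> 'b::real_normed_vector"
  assumes "closed K" "\<And>x. x \<notin> K \<Longrightarrow> f x = 0" "x \<notin> K"
  shows "(f has_derivative (\<lambda>_. 0)) (at x)"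
  by (rule has_derivative_transform_within_open[of "\<lambda>_. 0" _ _ _ "- K"])
     (use assms in auto)

text \<open>
  The difference quotients \<open>(w (x + h b) - w x) / h\<close> have integral zero, because Lebesgue measure
  is invariant under translation. For \<open>h \<le> 1\<close> the mean value theorem bounds them by a constant on
  a fixed ball outside which they vanish, so the limit \<open>h \<rightarrow> 0\<close> may be taken under the integral.
\<close>

lemma integral_directional_derivative_eq_0:
  fixes w :: "'a::euclidean_space \<Rightarrow> real"
  assumes w: "\<And>x. (w has_derivative W x) (at x)"
    and cont: "continuous_on UNIV (\<lambda>x. W x b)"
    and K: "compact K" and off: "\<And>x. x \<notin> K \<Longrightarrow> w x = 0"
  shows "(LINT x|lborel. W x b) = 0"
proof -
  define h where "h n = inverse (real (Suc n))" for n
  define q where "q n x = (w (h n *\<^sub>R b + x) - w x) / h n" for n x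
  have h: "0 < h n" "h n \<le> 1" for n
    by (auto simp: h_def inverse_le_1_iff)
  have W0: "W x b = 0" if "x \<notin> K" for x
  proof -
    have "(w has_derivative (\<lambda>_. 0)) (at x)"
      by (rule has_derivative_zero_off_support[of K]) (use K off that in \<open>auto intro: compact_imp_closed\<close>)
    from has_derivative_unique[OF w this] show ?thesis by simp
  qed
  obtain M where M: "\<bar>W x b\<bar> \<le> M" for x
  proof -
    have "bounded ((\<lambda>x. W x b) ` K)"
      using K cont by (meson compact_continuous_image compact_imp_bounded continuous_on_subset subset_UNIV)
    then obtain M where "\<And>x. x \<in> K \<Longrightarrow> \<bar>W x b\<bar> \<le> M" "0 < M"
      by (auto simp: bounded_pos)
    then have "\<bar>W x b\<bar> \<le> M" for x
      using W0[of x] by (cases "x \<in> K") auto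
    then show ?thesis by (rule that)
  qed
  obtain R where R: "\<And>x. x \<in> K \<Longrightarrow> norm x \<le> R"
    using compact_imp_bounded[OF K] by (auto simp: bounded_iff)
  have line: "((\<lambda>t. w (t *\<^sub>R b + x)) has_real_derivative W (t *\<^sub>R b + x) b) (at t)" for x t
  proof -
    have "((\<lambda>t. w (t *\<^sub>R b + x)) has_derivative (\<lambda>s. W (t *\<^sub>R b + x) (s *\<^sub>R b))) (at t)"
      by (rule has_derivative_compose[OF _ w]) (auto intro!: derivative_eq_intros)
    moreover have "W (t *\<^sub>R b + x) (s *\<^sub>R b) = W (t *\<^sub>R b + x) b * s" for s
      using has_derivative_bounded_linear[OF w] by (simp add: bounded_linear.axioms(1) linear.scaleR linear_simps(5))
    ultimately show ?thesis by (simp add: has_field_derivative_def)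
  qed
  have wcont: "continuous_on UNIV w"
    using w by (meson continuous_at_imp_continuous_on has_derivative_continuous)
  have wint: "integrable lborel w"
  proof -
    have "integrable lborel (\<lambda>x. indicator K x *\<^sub>R w x)"
      using K wcont by (intro borel_integrable_compact) (auto intro: continuous_on_subset)
    moreover have "(\<lambda>x. indicator K x *\<^sub>R w x) = w"
      using off by (auto simp: indicator_def fun_eq_iff)
    ultimately show ?thesis by simp
  qed
  have shift: "integrable lborel (\<lambda>x. w (c + x))" "(LINT x|lborel. w (c + x)) = (LINT x|lborel. w x)" for c
  proof -
    have wb: "w \<in> borel_measurable borel"
      using wcont by (rule borel_measurable_continuous_onI)
    have "integrable (distr lborel borel ((+) c)) w"
      using wint by (simp add: lborel_distr_plus)
    then show "integrable lborel (\<lambda>x. w (c + x))"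
      by (subst (asm) integrable_distr_eq) (auto intro: wb)
    have "(LINT x|lborel. w x) = (LINT x|distr lborel borel ((+) c). w x)"
      by (simp add: lborel_distr_plus)
    also have "\<dots> = (LINT x|lborel. w (c + x))"
      by (rule integral_distr) (auto intro: wb)
    finally show "(LINT x|lborel. w (c + x)) = (LINT x|lborel. w x)" ..
  qed
  have "(LINT x|lborel. q n x) = 0" for n
    using shift wint by (simp add: q_def)
  moreover have "(\<lambda>n. LINT x|lborel. q n x) \<longlonglongrightarrow> (LINT x|lborel. W x b)"
  proof (rule integral_dominated_convergence)
    show "(\<lambda>x. W x b) \<in> borel_measurable lborel"
      using borel_measurable_continuous_onI[OF cont] by simp
    show "q n \<in> borel_measurable lborel" for n
      using shift(1) wint unfolding q_def by (intro borel_measurable_divide borel_measurable_diff) auto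
    show "integrable lborel (\<lambda>x. indicator (cball 0 (R + norm b)) x *\<^sub>R M)"
      by (rule borel_integrable_compact) auto
    show "AE x in lborel. norm (q n x) \<le> indicator (cball 0 (R + norm b)) x *\<^sub>R M" for n
    proof (rule AE_I2)
      fix x
      show "norm (q n x) \<le> indicator (cball 0 (R + norm b)) x *\<^sub>R M"
      proof (cases "x \<in> cball 0 (R + norm b)")
        case True
        obtain t where "w (h n *\<^sub>R b + x) - w (0 *\<^sub>R b + x) = (h n - 0) * W (t *\<^sub>R b + x) b"
          using MVT2[where a=0 and b="h n" and f="\<lambda>t. w (t *\<^sub>R b + x)"
              and f'="\<lambda>t. W (t *\<^sub>R b + x) b"] h(1) line by blast
        then have "q n x = W (t *\<^sub>R b + x) b"
          using h(1)[of n] by (simp add: q_def)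
        then show ?thesis using M True by simp
      next
        case False
        have "norm (h n *\<^sub>R b) \<le> norm b"
          using h[of n] by (simp add: mult_left_le_one_le)
        moreover have "norm x \<le> norm (h n *\<^sub>R b + x) + norm (h n *\<^sub>R b)"
          using norm_triangle_ineq4[of "h n *\<^sub>R b + x" "h n *\<^sub>R b"] by simp
        ultimately have "norm (h n *\<^sub>R b + x) > R" "norm x > R"
          using False norm_ge_zero[of b] unfolding mem_cball_0 not_le by linarith+
        then have "w (h n *\<^sub>R b + x) = 0" "w x = 0"
          using R off by (meson not_less)+
        then show ?thesis using False by (simp add: q_def)
      qed
    qed
    show "AE x in lborel. (\<lambda>n. q n x) \<longlonglongrightarrow> W x b"
    proof (rule AE_I2)
      fix x
      have "((\<lambda>t. (w (t *\<^sub>R b + x) - w x) / t) \<longlongrightarrow> W x b) (at 0)"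
        using line[of x 0] by (simp add: DERIV_def)
      moreover have "filterlim h (at 0) sequentially"
        using LIMSEQ_inverse_real_of_nat h(1)
        by (auto simp: filterlim_at h_def[abs_def])
      ultimately show "(\<lambda>n. q n x) \<longlonglongrightarrow> W x b"
        unfolding q_def by (rule filterlim_compose)
    qed
  qed
  ultimately show ?thesis
    by (simp add: LIMSEQ_const_iff)
qed

text \<open>
  Passage from the completed measure restricted to \<open>\<Omega>\<close>, in which variations are defined, to the
  Borel measure on the whole space, in which translations act.
\<close>

lemma lebesgue_on_integral_compact_support:
  fixes f :: "'a::euclidean_space \<Rightarrow> real"
  assumes "open \<Omega>" "continuous_on \<Omega> f" "compact K" "K \<subseteq> \<Omega>"
    and off: "\<And>x. x \<in> \<Omega> \<Longrightarrow> x \<notin> K \<Longrightarrow> f x = 0"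
  shows "integrable (lebesgue_on \<Omega>) f"
    and "(LINT x|lebesgue_on \<Omega>. f x) = (LINT x|lborel. (if x \<in> \<Omega> then f x else 0))"
    and "integrable lborel (\<lambda>x. if x \<in> \<Omega> then f x else 0)"
proof -
  have \<Omega>: "\<Omega> \<inter> space lebesgue \<in> sets lebesgue"
    using assms by auto
  have eq: "indicator \<Omega> x *\<^sub>R f x = (if x \<in> \<Omega> then f x else 0)" 
           "indicator K x *\<^sub>R f x = (if x \<in> \<Omega> then f x else 0)" for x
    using assms(4) off by (auto simp: indicator_def)
  show int: "integrable lborel (\<lambda>x. if x \<in> \<Omega> then f x else 0)"
    using borel_integrable_compact[OF assms(3) continuous_on_subset[OF assms(2,4)]]
    by (simp only: eq)
  then have "(\<lambda>x. if x \<in> \<Omega> then f x else 0) \<in> borel_measurable lborel"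
    by simp
  then show "integrable (lebesgue_on \<Omega>) f"
    "(LINT x|lebesgue_on \<Omega>. f x) = (LINT x|lborel. (if x \<in> \<Omega> then f x else 0))"
    using int by (simp_all only: integrable_restrict_space[OF \<Omega>] integral_restrict_space[OF \<Omega>] eq
        integrable_completion integral_completion)
qed

lemma divergence_eq:
  "(z has_derivative D) (at x) \<Longrightarrow> divergence z x = (\<Sum>b\<in>Basis. D b \<bullet> b)"
  unfolding divergence_def using frechet_derivative_at by metis

lemma C1_compact_support_divergence:
  assumes "open \<Omega>" "C1_compact_support \<Omega> z"
  obtains K where "compact K" "K \<subseteq> \<Omega>" "\<And>x. x \<notin> K \<Longrightarrow> z x = 0" "\<And>x. x \<notin> K \<Longrightarrow> divergence z x = 0"
    "continuous_on \<Omega> z" "continuous_on \<Omega> (divergence z)"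
proof -
  obtain z' K where z': "\<And>x. x \<in> \<Omega> \<Longrightarrow> (z has_derivative blinfun_apply (z' x)) (at x)"
    and c: "continuous_on \<Omega> z'" and K: "compact K" "K \<subseteq> \<Omega>" "\<And>x. x \<notin> K \<Longrightarrow> z x = 0"
    using assms(2) unfolding C1_compact_support_def by blast
  have "divergence z x = 0" if "x \<notin> K" for x
  proof -
    have "(z has_derivative (\<lambda>_. 0)) (at x)"
      by (rule has_derivative_zero_off_support[of K]) (use K that in \<open>auto intro: compact_imp_closed\<close>)
    from divergence_eq[OF this] show ?thesis by simp
  qed
  moreover have "continuous_on \<Omega> z"
    using z' by (meson continuous_at_imp_continuous_on has_derivative_continuous)
  moreover have "continuous_on \<Omega> (\<lambda>x. \<Sum>b\<in>Basis. blinfun_apply (z' x) b \<bullet> b)"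
    using c by (intro continuous_intros)
  then have "continuous_on \<Omega> (divergence z)"
    by (simp add: divergence_eq[OF z'] cong: continuous_on_cong)
  ultimately show ?thesis using K that by blast
qed

text \<open>
  The zero extension of the derivative of a test field is continuous, since \<open>\<Omega>\<close> and the
  complement of the support form an open cover on each of whose members it is. So every summand
  of the divergence is a directional derivative to which the preceding result applies.
\<close>

lemma integral_divergence_eq_0:
  fixes z :: "'a::euclidean_space \<Rightarrow> 'a"
  assumes "open \<Omega>" "C1_compact_support \<Omega> z"
  shows "(LINT x|lebesgue_on \<Omega>. divergence z x) = 0"
proof -
  obtain z' K where z': "\<And>x. x \<in> \<Omega> \<Longrightarrow> (z has_derivative blinfun_apply (z' x)) (at x)"
    and c: "continuous_on \<Omega> z'" and K: "compact K" "K \<subseteq> \<Omega>" "\<And>x. x \<notin> K \<Longrightarrow> z x = 0"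
    using assms(2) unfolding C1_compact_support_def by blast
  define D where "D x = (if x \<in> \<Omega> then z' x else 0)" for x
  have zero: "(z has_derivative (\<lambda>_. 0)) (at x)" if "x \<notin> K" for x
    by (rule has_derivative_zero_off_support[of K]) (use K that in \<open>auto intro: compact_imp_closed\<close>)
  have D: "(z has_derivative blinfun_apply (D x)) (at x)" for x
    using z' zero[where x=x] K(2) by (auto simp: D_def zero_blinfun.rep_eq)
  have D0: "D x = 0" if "x \<notin> K" for x
    using has_derivative_unique[OF D zero[OF that]] by (auto intro: blinfun_eqI)
  have Dc: "continuous_on UNIV D"
  proof -
    have "continuous_on \<Omega> D"
      using c by (simp add: D_def cong: continuous_on_cong)
    moreover have "continuous_on (- K) D"
      by (rule continuous_on_eq[OF continuous_on_const[of _ 0]]) (simp add: D0)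
    ultimately have "continuous_on (\<Omega> \<union> - K) D"
      using assms(1) K(1) by (intro continuous_on_open_Un) (auto intro: compact_imp_closed)
    moreover have "\<Omega> \<union> - K = UNIV" using K(2) by auto
    ultimately show ?thesis by simp
  qed
  have comp: "(LINT x|lborel. blinfun_apply (D x) b \<bullet> b) = 0"
       "integrable lborel (\<lambda>x. blinfun_apply (D x) b \<bullet> b)" for b
  proof -
    have cont: "continuous_on UNIV (\<lambda>x. blinfun_apply (D x) b \<bullet> b)"
      using Dc by (intro continuous_intros)
    show "(LINT x|lborel. blinfun_apply (D x) b \<bullet> b) = 0"
      by (rule integral_directional_derivative_eq_0[where w="\<lambda>x. z x \<bullet> b" and K=K])
         (use cont K in \<open>auto intro!: has_derivative_inner_left D\<close>)
    show "integrable lborel (\<lambda>x. blinfun_apply (D x) b \<bullet> b)"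
      using lebesgue_on_integral_compact_support(3)[OF open_UNIV cont K(1)] D0 by simp
  qed
  obtain K' where K': "compact K'" "K' \<subseteq> \<Omega>" "\<And>x. x \<notin> K' \<Longrightarrow> divergence z x = 0"
    "continuous_on \<Omega> (divergence z)"
    using C1_compact_support_divergence[OF assms] by metis
  have "(LINT x|lebesgue_on \<Omega>. divergence z x) = (LINT x|lborel. (if x \<in> \<Omega> then divergence z x else 0))"
    by (rule lebesgue_on_integral_compact_support(2)[OF assms(1) K'(4,1,2)]) (use K' in auto)
  also have "\<dots> = (LINT x|lborel. (\<Sum>b\<in>Basis. blinfun_apply (D x) b \<bullet> b))"
  proof (rule Bochner_Integration.integral_cong[OF refl])
    show "(if x \<in> \<Omega> then divergence z x else 0) = (\<Sum>b\<in>Basis. blinfun_apply (D x) b \<bullet> b)" for x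
      using divergence_eq[OF D] by (auto simp: D_def)
  qed
  also have "\<dots> = 0"
    using comp by simp
  finally show ?thesis .
qed

lemma C1_compact_support_scaleR:
  assumes u: "C1_gradient_on \<Omega> u g" and z: "C1_compact_support \<Omega> z"
  shows "C1_compact_support \<Omega> (\<lambda>x. u x *\<^sub>R z x)"
    and "x \<in> \<Omega> \<Longrightarrow> divergence (\<lambda>x. u x *\<^sub>R z x) x = u x * divergence z x + g x \<bullet> z x"
proof -
  obtain z' K where z': "\<And>x. x \<in> \<Omega> \<Longrightarrow> (z has_derivative blinfun_apply (z' x)) (at x)"
    and c: "continuous_on \<Omega> z'" and K: "compact K" "K \<subseteq> \<Omega>" "\<And>x. x \<notin> K \<Longrightarrow> z x = 0"
    using z unfolding C1_compact_support_def by blast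
  have u': "\<And>x. x \<in> \<Omega> \<Longrightarrow> (u has_derivative (\<lambda>h. g x \<bullet> h)) (at x)" and gc: "continuous_on \<Omega> g"
    using u by (auto simp: C1_gradient_on_def)
  define D where "D x = u x *\<^sub>R z' x + (blinfun_scaleR_left (z x) o\<^sub>L blinfun_inner_right (g x))" for x
  have D_apply: "blinfun_apply (D x) h = u x *\<^sub>R blinfun_apply (z' x) h + (g x \<bullet> h) *\<^sub>R z x" for x h
    by (simp add: D_def blinfun.add_left blinfun.scaleR_left)
  have D: "((\<lambda>x. u x *\<^sub>R z x) has_derivative blinfun_apply (D x)) (at x)" if "x \<in> \<Omega>" for x
    using has_derivative_scaleR[OF u'[OF that] z'[OF that]] by (simp add: D_apply[abs_def])
  have "continuous_on \<Omega> z"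
    using z' by (meson continuous_at_imp_continuous_on has_derivative_continuous)
  then have "continuous_on \<Omega> D"
    unfolding D_def using c gc C1_gradient_on_imp_continuous_on[OF u]
    by (intro continuous_intros bounded_linear.continuous_on[OF bounded_linear_blinfun_scaleR_left]
          bounded_linear.continuous_on[OF bounded_linear_blinfun_inner_right])
  then show "C1_compact_support \<Omega> (\<lambda>x. u x *\<^sub>R z x)"
    unfolding C1_compact_support_def using D K by (metis scaleR_zero_right)
  assume x: "x \<in> \<Omega>"
  have "(\<Sum>b\<in>Basis. (g x \<bullet> b) * (z x \<bullet> b)) = g x \<bullet> z x"
    by (rule euclidean_inner[symmetric])
  then show "divergence (\<lambda>x. u x *\<^sub>R z x) x = u x * divergence z x + g x \<bullet> z x"
    by (simp add: divergence_eq[OF D[OF x]] divergence_eq[OF z'[OF x]] D_apply inner_add_left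
        sum.distrib sum_distrib_left)
qed

text \<open>
  Integration by parts: the field \<open>u z\<close> is again a test field, hence its divergence
  \<open>u div z + g \<bullet> z\<close> integrates to zero.
\<close>

lemma integral_mult_divergence:
  fixes z :: "'a::euclidean_space \<Rightarrow> 'a"
  assumes "open \<Omega>" and u: "C1_gradient_on \<Omega> u g" and z: "C1_compact_support \<Omega> z"
  shows "(LINT x|lebesgue_on \<Omega>. u x * divergence z x) = (LINT x|lebesgue_on \<Omega>. - (g x \<bullet> z x))"
    and "integrable (lebesgue_on \<Omega>) (\<lambda>x. - (g x \<bullet> z x))"
proof -
  obtain K where K: "compact K" "K \<subseteq> \<Omega>" "\<And>x. x \<notin> K \<Longrightarrow> z x = 0" "\<And>x. x \<notin> K \<Longrightarrow> divergence z x = 0"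
    "continuous_on \<Omega> z" "continuous_on \<Omega> (divergence z)"
    using C1_compact_support_divergence[OF assms(1) z] by metis
  have gc: "continuous_on \<Omega> g"
    using u by (simp add: C1_gradient_on_def)
  have i1: "integrable (lebesgue_on \<Omega>) (\<lambda>x. u x * divergence z x)"
    by (rule lebesgue_on_integral_compact_support(1)[OF assms(1) _ K(1,2)])
       (use K C1_gradient_on_imp_continuous_on[OF u] in \<open>auto intro!: continuous_intros\<close>)
  have i2: "integrable (lebesgue_on \<Omega>) (\<lambda>x. g x \<bullet> z x)"
    by (rule lebesgue_on_integral_compact_support(1)[OF assms(1) _ K(1,2)])
       (use K gc in \<open>auto intro!: continuous_intros\<close>)
  have "0 = (LINT x|lebesgue_on \<Omega>. divergence (\<lambda>x. u x *\<^sub>R z x) x)"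
    using integral_divergence_eq_0[OF assms(1) C1_compact_support_scaleR(1)[OF u z]] by simp
  also have "\<dots> = (LINT x|lebesgue_on \<Omega>. u x * divergence z x + g x \<bullet> z x)"
    by (rule Bochner_Integration.integral_cong)
       (auto simp: C1_compact_support_scaleR(2)[OF u z])
  also have "\<dots> = (LINT x|lebesgue_on \<Omega>. u x * divergence z x) + (LINT x|lebesgue_on \<Omega>. g x \<bullet> z x)"
    using i1 i2 by (rule Bochner_Integration.integral_add)
  finally show "(LINT x|lebesgue_on \<Omega>. u x * divergence z x) = (LINT x|lebesgue_on \<Omega>. - (g x \<bullet> z x))"
    by simp
  show "integrable (lebesgue_on \<Omega>) (\<lambda>x. - (g x \<bullet> z x))"
    using i2 by simp
qed

section \<open>Least gradient functions calibrated by a constant field\<close>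

lemma has_real_derivative_square_positive_part:
  "((\<lambda>t::real. (max 0 t)\<^sup>2) has_real_derivative 2 * max 0 t) (at t)"
proof -
  consider "t < 0" | "t = 0" | "t > 0" by linarith
  then show ?thesis
  proof cases
    case 1
    have "((\<lambda>t::real. 0) has_real_derivative 2 * max 0 t) (at t)"
      using 1 by (auto intro!: derivative_eq_intros)
    then show ?thesis
      by (rule DERIV_cong_ev[OF refl _ refl, THEN iffD1, rotated])
         (use 1 eventually_nhds_in_open[of "{..<0}" t] in \<open>auto elim!: eventually_mono\<close>)
  next
    case 2
    have "((\<lambda>s::real. max 0 s) \<longlongrightarrow> max 0 0) (at 0)"
      by (intro tendsto_intros)
    then have "((\<lambda>s::real. (max 0 s)\<^sup>2 / s) \<longlongrightarrow> max 0 0) (at 0)"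
      by (rule Lim_transform_eventually[where f="max 0", OF _ _])
         (auto simp: eventually_at_filter max_def power2_eq_square)
    then show ?thesis
      using 2 by (simp add: DERIV_def)
  next
    case 3
    have "((\<lambda>t::real. t\<^sup>2) has_real_derivative 2 * max 0 t) (at t)"
      using 3 by (auto intro!: derivative_eq_intros)
    then show ?thesis
      by (rule DERIV_cong_ev[OF refl _ refl, THEN iffD1, rotated])
         (use 3 eventually_nhds_in_open[of "{0<..}" t] in \<open>auto elim!: eventually_mono\<close>)
  qed
qed

text \<open>
  With \<open>q t = (max 0 t)\<^sup>2\<close>, the function \<open>q (1 - q t)\<close> is a \<open>C\<^sup>1\<close> step: it is \<open>1\<close> for \<open>t \<le> 0\<close>
  and \<open>0\<close> for \<open>t \<ge> 1\<close>. It is composed with the affine function of \<open>\<bar>x\<bar>\<^sup>2\<close> that takes the value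
  \<open>0\<close> on the sphere of radius \<open>r\<close> and \<open>1\<close> on that of radius \<open>s\<close>.
\<close>

lemma C1_cutoff_cball:
  fixes r s :: real
  assumes "0 \<le> r" "r < s"
  obtains \<psi> :: "'a::euclidean_space \<Rightarrow> real" and g where "C1_gradient_on UNIV \<psi> g"
    "\<And>x. 0 \<le> \<psi> x" "\<And>x. \<psi> x \<le> 1"
    "\<And>x. x \<in> cball 0 r \<Longrightarrow> \<psi> x = 1" "\<And>x. x \<in> cball 0 r \<Longrightarrow> g x = 0"
    "\<And>x. x \<notin> cball 0 s \<Longrightarrow> \<psi> x = 0"
proof -
  have c: "0 < s\<^sup>2 - r\<^sup>2"
    using assms by (simp add: power_strict_mono)
  define T where "T x = (x \<bullet> x - r\<^sup>2) / (s\<^sup>2 - r\<^sup>2)" for x :: 'a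
  define q where "q t = (max 0 t)\<^sup>2" for t :: real
  define q' where "q' t = 2 * max 0 t" for t :: real
  define \<psi> where "\<psi> x = q (1 - q (T x))" for x
  define g where "g x = (- q' (1 - q (T x)) * q' (T x) * 2 / (s\<^sup>2 - r\<^sup>2)) *\<^sub>R x" for x
  have q: "(q has_derivative (\<lambda>h. q' t * h)) (at t)" for t
    using has_real_derivative_square_positive_part[of t]
    by (simp add: q_def[abs_def] q'_def has_field_derivative_def)
  have T: "(T has_derivative (\<lambda>h. 2 * (x \<bullet> h) / (s\<^sup>2 - r\<^sup>2))) (at x)" for x
    unfolding T_def[abs_def] using c
    by (auto intro!: derivative_eq_intros simp: inner_commute)
  have "((\<lambda>x. 1 - q (T x)) has_derivative (\<lambda>h. - (q' (T x) * (2 * (x \<bullet> h) / (s\<^sup>2 - r\<^sup>2))))) (at x)" for x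
    using has_derivative_diff[OF has_derivative_const[of 1] has_derivative_compose[OF T q]] by simp
  from has_derivative_compose[OF this q]
  have "(\<psi> has_derivative (\<lambda>h. g x \<bullet> h)) (at x)" for x
    unfolding \<psi>_def[abs_def] g_def by (rule has_derivative_eq_rhs) (simp add: fun_eq_iff)
  moreover have "continuous_on UNIV g"
    unfolding g_def q'_def q_def T_def using c by (intro continuous_intros) auto
  moreover have "q t = 0" "q' t = 0" if "t \<le> 0" for t
    using that by (auto simp: q_def q'_def)
  moreover have "T x \<le> 0" if "x \<in> cball 0 r" for x
  proof -
    have "x \<bullet> x \<le> r\<^sup>2"
      using that assms by (simp add: dot_square_norm power_mono)
    then show ?thesis using c by (simp add: T_def divide_nonpos_pos)
  qed
  moreover have "q (T x) \<ge> 1" if "x \<notin> cball 0 s" for x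
  proof -
    have "s\<^sup>2 \<le> x \<bullet> x"
      using that assms by (simp add: dot_square_norm power_mono)
    then have "1 \<le> T x" using c by (simp add: T_def)
    then show ?thesis by (simp add: q_def one_le_power)
  qed
  moreover have "q (1 - q t) \<le> 1" "0 \<le> q t" for t
    by (auto simp: q_def max_def power_le_one)
  ultimately show ?thesis
    by (intro that[of \<psi> g]) (auto simp: C1_gradient_on_def \<psi>_def g_def q_def[of 1])
qed

text \<open>
  The lower bound on \<open>\<phi>\<close> makes its unit ball bounded, so that the supremum defining the polar
  is taken over a set that is bounded above; the inequality follows by scaling \<open>\<xi>\<close> to \<open>\<phi> \<xi> = 1\<close>.
\<close>

lemma inner_le_of_polar_integrand_le_1:
  assumes \<phi>: "metric_integrand \<phi>" and "polar_integrand \<phi> \<eta> \<le> 1"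
  shows "\<eta> \<bullet> \<xi> \<le> \<phi> \<xi>"
proof (cases "\<xi> = 0")
  case True
  then show ?thesis using \<phi> by (auto simp: metric_integrand_def)
next
  case False
  obtain \<gamma> where \<gamma>: "\<gamma> > 0" "\<And>\<xi>. \<gamma> * norm \<xi> \<le> \<phi> \<xi>"
    using \<phi> by (auto simp: metric_integrand_def)
  have hom: "\<phi> (t *\<^sub>R \<xi>) = \<bar>t\<bar> * \<phi> \<xi>" for t \<xi>
    using \<phi> by (auto simp: metric_integrand_def)
  have pos: "\<phi> \<xi> > 0"
    using \<gamma> False by (meson less_le_trans mult_pos_pos zero_less_norm_iff)
  have "bdd_above ((\<lambda>\<xi>. \<eta> \<bullet> \<xi>) ` {\<xi>. \<phi> \<xi> \<le> 1})"
  proof (rule bdd_aboveI2)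
    fix x assume "x \<in> {\<xi>. \<phi> \<xi> \<le> 1}"
    then have "\<gamma> * norm x \<le> 1"
      using \<gamma>(2)[of x] by simp
    then have "norm x \<le> 1 / \<gamma>"
      using \<gamma>(1) by (simp add: field_simps)
    then have "norm \<eta> * norm x \<le> norm \<eta> * (1 / \<gamma>)"
      by (rule mult_left_mono) simp
    then show "\<eta> \<bullet> x \<le> norm \<eta> * (1 / \<gamma>)"
      using norm_cauchy_schwarz[of \<eta> x] by linarith
  qed
  then have "\<eta> \<bullet> (inverse (\<phi> \<xi>) *\<^sub>R \<xi>) \<le> polar_integrand \<phi> \<eta>"
    unfolding polar_integrand_def 
    by (rule cSUP_upper[rotated]) (use pos in \<open>auto simp: hom\<close>)
  then have "inverse (\<phi> \<xi>) * (\<eta> \<bullet> \<xi>) \<le> 1"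
    using assms(2) by simp
  then show ?thesis
    using pos by (simp add: field_simps)
qed

lemma polar_integrand_le_1:
  assumes \<phi>: "metric_integrand \<phi>" and "\<And>\<xi>. \<eta> \<bullet> \<xi> \<le> \<phi> \<xi>"
  shows "polar_integrand \<phi> \<eta> \<le> 1"
proof -
  have "\<phi> (0 *\<^sub>R 0) = 0"
    using \<phi> unfolding metric_integrand_def by (metis abs_zero mult_zero_left)
  then have "0 \<in> {\<xi>. \<phi> \<xi> \<le> 1}"
    by simp
  then show ?thesis
    unfolding polar_integrand_def using assms(2)
    by (intro cSUP_least) (auto intro: order_trans)
qed

lemma C1_gradient_on_in_BV:
  assumes \<Omega>: "open \<Omega>" and u: "C1_gradient_on \<Omega> u g"
    and int: "integrable (lebesgue_on \<Omega>) u" "integrable (lebesgue_on \<Omega>) (\<lambda>x. norm (g x))"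
  shows "u \<in> BV \<Omega>"
proof -
  have "total_variation \<Omega> u \<le> ereal (LINT x|lebesgue_on \<Omega>. norm (g x))"
    unfolding total_variation_def
  proof (rule SUP_least, clarify)
    fix z assume z: "C1_compact_support \<Omega> z" "\<forall>x\<in>\<Omega>. norm (z x) \<le> 1"
    have "(LINT x|lebesgue_on \<Omega>. u x * divergence z x) = (LINT x|lebesgue_on \<Omega>. - (g x \<bullet> z x))"
      by (rule integral_mult_divergence(1)[OF \<Omega> u z(1)])
    also have "\<dots> \<le> (LINT x|lebesgue_on \<Omega>. norm (g x))"
    proof (rule integral_mono[OF integral_mult_divergence(2)[OF \<Omega> u z(1)] int(2)])
      fix x assume "x \<in> space (lebesgue_on \<Omega>)"
      then have "norm (g x) * norm (z x) \<le> norm (g x)"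
        using z(2) by (simp add: mult_left_le)
      then show "- (g x \<bullet> z x) \<le> norm (g x)"
        using Cauchy_Schwarz_ineq2[of "g x" "z x"] by linarith
    qed
    finally show "ereal (LINT x|lebesgue_on \<Omega>. u x * divergence z x) \<le> ereal (LINT x|lebesgue_on \<Omega>. norm (g x))"
      by simp
  qed
  then show ?thesis
    using int(1) by (auto simp: BV_def)
qed

text \<open>
  Calibration by the constant field \<open>\<nu>\<close>. Instead of comparing the two suprema with
  \<open>\<integral> \<phi> (g x)\<close>, the proof matches every test field \<open>z\<close> for \<open>u\<close> with a test field \<open>- \<psi> \<nu>\<close> for
  \<open>u + v\<close> that does at least as well. The cutoff \<open>\<psi>\<close> equals \<open>1\<close> on the supports of \<open>v\<close> and of \<open>z\<close>.
  On the support of \<open>v\<close> the field \<open>- \<psi> \<nu>\<close> has no divergence, so it does not see \<open>v\<close>; and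
  integration by parts turns the comparison into
  \<open>- (g \<bullet> z) \<le> \<psi> \<phi>(g) = \<psi> (\<nu> \<bullet> g)\<close>, which holds almost everywhere: on the support of \<open>z\<close> by the
  bound on the polar, elsewhere because the left-hand side is zero and \<open>\<psi> \<phi>(g) \<ge> 0\<close>.
\<close>

lemma least_gradient_if_calibrated:
  fixes \<phi> :: "'a::euclidean_space \<Rightarrow> real"
  assumes \<phi>: "metric_integrand \<phi>"
    and u: "C1_gradient_on (ball 0 1) u g" and uBV: "u \<in> BV (ball 0 1)"
    and \<nu>: "\<And>\<xi>. \<nu> \<bullet> \<xi> \<le> \<phi> \<xi>" and cal: "\<And>x. x \<in> ball 0 1 \<Longrightarrow> \<phi> (g x) = \<nu> \<bullet> g x"
  shows "least_gradient \<phi> (ball 0 1) u"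
  unfolding least_gradient_def
proof (intro conjI ballI impI)
  let ?\<Omega> = "ball 0 1 :: 'a set"
  have \<phi>0: "0 \<le> \<phi> \<xi>" and even: "\<phi> (- \<xi>) = \<phi> \<xi>" for \<xi>
    using \<phi> by (auto simp: metric_integrand_def dest: spec[where x="-1"])
  show "u \<in> BV ?\<Omega>" by fact
  fix v assume v: "v \<in> BV ?\<Omega>" and "compactly_supported_in ?\<Omega> v"
  then obtain K where K: "compact K" "K \<subseteq> ?\<Omega>" "AE x in lebesgue_on ?\<Omega>. x \<notin> K \<longrightarrow> v x = 0"
    unfolding compactly_supported_in_def by blast
  show "anisotropic_variation \<phi> ?\<Omega> u \<le> anisotropic_variation \<phi> ?\<Omega> (\<lambda>x. u x + v x)"
    unfolding anisotropic_variation_def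
  proof (rule SUP_mono, clarify)
    fix z assume z: "C1_compact_support ?\<Omega> z" and zp: "AE x in lebesgue_on ?\<Omega>. polar_integrand \<phi> (z x) \<le> 1"
    obtain L where L: "compact L" "L \<subseteq> ?\<Omega>" "\<And>x. x \<notin> L \<Longrightarrow> z x = 0"
      using C1_compact_support_divergence[OF open_ball z] by metis
    obtain r where r: "0 \<le> r" "r < 1" "K \<union> L \<subseteq> cball 0 r"
    proof (cases "K \<union> L = {}")
      case True
      then show ?thesis by (intro that[of 0]) auto
    next
      case False
      have "continuous_on (K \<union> L) norm"
        by (intro continuous_intros)
      then obtain y where "y \<in> K \<union> L" "\<And>x. x \<in> K \<union> L \<Longrightarrow> norm x \<le> norm y"
        using continuous_attains_sup[of "K \<union> L" norm] False K(1) L(1) by blast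
      then show ?thesis
        using K(2) L(2) by (intro that[of "norm y"]) auto
    qed
    define s where "s = (r + 1) / 2"
    have s: "r < s" "s < 1" using r by (auto simp: s_def)
    obtain \<psi> :: "'a \<Rightarrow> real" and g\<psi> where \<psi>: "C1_gradient_on UNIV \<psi> g\<psi>" "\<And>x. 0 \<le> \<psi> x" "\<And>x. \<psi> x \<le> 1"
      "\<And>x. x \<in> cball 0 r \<Longrightarrow> \<psi> x = 1" "\<And>x. x \<in> cball 0 r \<Longrightarrow> g\<psi> x = 0"
      "\<And>x. x \<notin> cball 0 s \<Longrightarrow> \<psi> x = 0"
      using C1_cutoff_cball[OF r(1) s(1)] by metis
    define y where "y x = - \<psi> x *\<^sub>R \<nu>" for x
    have y': "(y has_derivative blinfun_apply (- (blinfun_scaleR_left \<nu> o\<^sub>L blinfun_inner_right (g\<psi> x)))) (at x)" for x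
    proof -
      have "(\<psi> has_derivative (\<lambda>h. g\<psi> x \<bullet> h)) (at x)"
        using \<psi>(1) by (auto simp: C1_gradient_on_def)
      then show ?thesis
        unfolding y_def[abs_def]
        by (auto intro!: derivative_eq_intros simp: blinfun.minus_left fun_eq_iff)
    qed
    have y: "C1_compact_support ?\<Omega> y"
      unfolding C1_compact_support_def
    proof (intro conjI exI ballI allI impI)
      show "(y has_derivative blinfun_apply (- (blinfun_scaleR_left \<nu> o\<^sub>L blinfun_inner_right (g\<psi> x)))) (at x)" for x
        by (rule y')
      show "continuous_on ?\<Omega> (\<lambda>x. - (blinfun_scaleR_left \<nu> o\<^sub>L blinfun_inner_right (g\<psi> x)))"
        using \<psi>(1) unfolding C1_gradient_on_def
        by (intro continuous_intros bounded_linear.continuous_on[OF bounded_linear_blinfun_inner_right])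
           (auto intro: continuous_on_subset)
      show "compact (cball (0::'a) s)" "cball 0 s \<subseteq> ?\<Omega>"
        using s by auto
      show "y x = 0" if "x \<notin> cball 0 s" for x
        using \<psi>(6) that by (simp add: y_def)
    qed
    \<comment> \<open>The competitor is blind to \<open>v\<close>.\<close>
    have ydiv: "divergence y x = 0" if "x \<in> K" for x
      using divergence_eq[OF y'[of x]] \<psi>(5) that r(3) by (auto simp: blinfun.minus_left)
    have yp: "polar_integrand \<phi> (y x) \<le> 1" for x
    proof (rule polar_integrand_le_1[OF \<phi>])
      fix \<xi>
      have "\<psi> x * (\<nu> \<bullet> (- \<xi>)) \<le> \<psi> x * \<phi> (- \<xi>)"
        using \<nu> \<psi>(2) by (rule mult_left_mono)
      also have "\<dots> \<le> \<phi> \<xi>"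
        using \<phi>0 \<psi>(2,3) by (simp add: even mult_left_le_one_le)
      finally show "y x \<bullet> \<xi> \<le> \<phi> \<xi>" by (simp add: y_def)
    qed
    have ub: "(LINT x|lebesgue_on ?\<Omega>. u x * divergence z x) \<le> (LINT x|lebesgue_on ?\<Omega>. u x * divergence y x)"
      unfolding integral_mult_divergence(1)[OF open_ball u z] integral_mult_divergence(1)[OF open_ball u y]
    proof (rule integral_mono_AE[OF integral_mult_divergence(2)[OF open_ball u z] integral_mult_divergence(2)[OF open_ball u y]])
      show "AE x in lebesgue_on ?\<Omega>. - (g x \<bullet> z x) \<le> - (g x \<bullet> y x)"
        using zp AE_space
      proof eventually_elim
        case (elim x)
        then have x: "x \<in> ?\<Omega>" by simp
        have *: "- (g x \<bullet> y x) = \<psi> x * \<phi> (g x)"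
          by (simp add: y_def cal[OF x] inner_commute)
        show ?case
        proof (cases "x \<in> L")
          case True
          have "z x \<bullet> (- g x) \<le> \<phi> (- g x)"
            using inner_le_of_polar_integrand_le_1[OF \<phi>] elim by blast
          moreover have "\<psi> x = 1"
            using True r(3) \<psi>(4) by blast
          ultimately show ?thesis
            unfolding * by (simp add: even inner_commute)
        next
          case False
          then show ?thesis
            unfolding * using L(3) \<phi>0 \<psi>(2) by simp
        qed
      qed
    qed
    have meas: "u \<in> borel_measurable (lebesgue_on ?\<Omega>)" "v \<in> borel_measurable (lebesgue_on ?\<Omega>)"
      using uBV v by (auto simp: BV_def)
    have "continuous_on ?\<Omega> (divergence y)"
      using C1_compact_support_divergence[OF open_ball y] by metis
    then have "divergence y \<in> borel_measurable (lebesgue_on ?\<Omega>)"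
      by (rule continuous_imp_measurable_on_sets_lebesgue) simp
    then have "(LINT x|lebesgue_on ?\<Omega>. (u x + v x) * divergence y x) = (LINT x|lebesgue_on ?\<Omega>. u x * divergence y x)"
      using meas
    proof (intro integral_cong_AE)
      show "AE x in lebesgue_on ?\<Omega>. (u x + v x) * divergence y x = u x * divergence y x"
        using K(3) by eventually_elim (use ydiv in auto)
    qed auto
    with ub y yp show "\<exists>y\<in>{z. C1_compact_support ?\<Omega> z \<and> (AE x in lebesgue_on ?\<Omega>. polar_integrand \<phi> (z x) \<le> 1)}.
        ereal (LINT x|lebesgue_on ?\<Omega>. u x * divergence z x) \<le> ereal (LINT x|lebesgue_on ?\<Omega>. (u x + v x) * divergence y x)"
      by (intro bexI[of _ y]) auto
  qed
qed

section \<open>Flat pieces of the unit ball of an integrand\<close>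

lemma metric_integrand_frontier_ball:
  assumes \<phi>: "metric_integrand \<phi>"
  shows "frontier (integrand_ball \<phi>) \<subseteq> {\<xi>. \<phi> \<xi> = 1}"
proof -
  have "continuous_on UNIV \<phi>"
    using \<phi> by (intro convex_on_continuous) (auto simp: metric_integrand_def)
  then have "open {\<xi>. \<phi> \<xi> < 1}" "closed {\<xi>. \<phi> \<xi> \<le> 1}"
    by (auto intro!: open_Collect_less closed_Collect_le continuous_intros)
  then have int: "{\<xi>. \<phi> \<xi> < 1} \<subseteq> interior (integrand_ball \<phi>)"
    by (intro interior_maximal) (auto simp: integrand_ball_def)
  have cl: "closure (integrand_ball \<phi>) = integrand_ball \<phi>"
    unfolding integrand_ball_def by (rule closure_closed) fact
  have "\<phi> \<xi> = 1" if "\<xi> \<in> frontier (integrand_ball \<phi>)" for \<xi>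
  proof -
    have "\<phi> \<xi> \<le> 1" "\<not> \<phi> \<xi> < 1"
      using that int cl unfolding frontier_def by (auto simp: integrand_ball_def)
    then show ?thesis by linarith
  qed
  then show ?thesis by blast
qed

text \<open>
  A supporting hyperplane of the unit ball at \<open>m\<close>, normalized to \<open>\<nu> \<bullet> m = 1\<close>. This is possible
  because the ball contains a neighbourhood of the origin, and by homogeneity the bound
  \<open>\<nu> \<bullet> \<xi> \<le> 1\<close> on the ball becomes \<open>\<nu> \<bullet> \<xi> \<le> \<phi> \<xi>\<close> everywhere.
\<close>

lemma supporting_functional:
  fixes \<phi> :: "'a::euclidean_space \<Rightarrow> real"
  assumes \<phi>: "metric_integrand \<phi>" and m: "m \<in> frontier (integrand_ball \<phi>)"
  obtains \<nu> where "\<nu> \<bullet> m = 1" "\<And>\<xi>. \<nu> \<bullet> \<xi> \<le> \<phi> \<xi>"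
proof -
  let ?B = "integrand_ball \<phi>"
  have hom: "\<phi> (t *\<^sub>R \<xi>) = \<bar>t\<bar> * \<phi> \<xi>" and \<phi>0: "0 \<le> \<phi> \<xi>" for t \<xi>
    using \<phi> by (auto simp: metric_integrand_def)
  obtain \<gamma> \<Gamma> where \<gamma>: "0 < \<gamma>" "\<And>\<xi>. \<gamma> * norm \<xi> \<le> \<phi> \<xi>" and \<Gamma>: "0 < \<Gamma>" "\<And>\<xi>. \<phi> \<xi> \<le> \<Gamma> * norm \<xi>"
    using \<phi> by (auto simp: metric_integrand_def)
  have small: "\<xi> \<in> ?B" if "norm \<xi> \<le> 1 / \<Gamma>" for \<xi>
  proof -
    have "\<Gamma> * norm \<xi> \<le> \<Gamma> * (1 / \<Gamma>)"
      using that \<Gamma>(1) by (intro mult_left_mono) auto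
    also have "\<dots> = 1" using \<Gamma>(1) by simp
    finally have "\<Gamma> * norm \<xi> \<le> 1" .
    then show ?thesis using \<Gamma>(2)[of \<xi>] by (simp add: integrand_ball_def)
  qed
  have conv: "convex ?B"
  proof (rule convexI)
    fix x y and s t :: real
    assume *: "x \<in> ?B" "y \<in> ?B" "0 \<le> s" "0 \<le> t" "s + t = 1"
    have "\<phi> (s *\<^sub>R x + t *\<^sub>R y) \<le> s * \<phi> x + t * \<phi> y"
      using \<phi> * by (simp add: metric_integrand_def convex_on_def)
    also have "\<dots> \<le> 1"
      using * by (intro convex_bound_le) (auto simp: integrand_ball_def)
    finally show "s *\<^sub>R x + t *\<^sub>R y \<in> ?B"
      by (simp add: integrand_ball_def)
  qed
  have "ball 0 (1 / \<Gamma>) \<subseteq> interior ?B"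
    using small by (intro interior_maximal) auto
  moreover have "0 \<in> ball (0::'a) (1 / \<Gamma>)" using \<Gamma>(1) by simp
  ultimately have "interior ?B \<noteq> {}" by blast
  then have "m \<notin> rel_interior ?B"
    using m by (simp add: rel_interior_nonempty_interior frontier_def)
  then obtain a where a: "a \<noteq> 0" "\<And>y. y \<in> closure ?B \<Longrightarrow> a \<bullet> m \<le> a \<bullet> y"
    using supporting_hyperplane_relative_frontier[OF conv] m unfolding frontier_def by blast
  have a': "(- a) \<bullet> y \<le> (- a) \<bullet> m" if "y \<in> ?B" for y
    using a(2)[of y] that closure_subset[of ?B] by auto
  define c where "c = (- a) \<bullet> m"
  have c: "c > 0"
  proof -
    have "(- a) \<bullet> ((- 1 / (\<Gamma> * norm a)) *\<^sub>R a) \<le> c"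
      \<comment> \<open>the point of norm \<open>1 / \<Gamma>\<close> in the direction of \<open>- a\<close>\<close>
      unfolding c_def using \<Gamma>(1) a(1) by (intro a' small) simp
    moreover have "(- a) \<bullet> ((- 1 / (\<Gamma> * norm a)) *\<^sub>R a) > 0"
      using \<Gamma>(1) a(1) by simp
    ultimately show ?thesis by linarith
  qed
  show ?thesis
  proof (rule that[of "(- 1 / c) *\<^sub>R a"])
    show "((- 1 / c) *\<^sub>R a) \<bullet> m = 1"
      using c by (simp add: c_def)
    fix \<xi>
    show "((- 1 / c) *\<^sub>R a) \<bullet> \<xi> \<le> \<phi> \<xi>"
    proof (cases "\<xi> = 0")
      case False
      then have pos: "\<phi> \<xi> > 0"
        using \<gamma> by (meson less_le_trans mult_pos_pos zero_less_norm_iff)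
      then have "(- a) \<bullet> (inverse (\<phi> \<xi>) *\<^sub>R \<xi>) \<le> c"
        unfolding c_def by (intro a') (simp add: integrand_ball_def hom)
      then have "- (a \<bullet> \<xi>) / \<phi> \<xi> \<le> c"
        by (simp add: divide_inverse mult.commute)
      then have "- (a \<bullet> \<xi>) \<le> \<phi> \<xi> * c"
        unfolding pos_divide_le_eq[OF pos] by (simp add: mult.commute)
      then have "- (a \<bullet> \<xi>) / c \<le> \<phi> \<xi>"
        unfolding pos_divide_le_eq[OF c] .
      then show ?thesis
        by simp
    qed (simp add: \<phi>0)
  qed
qed

lemma linear_on_cone:
  assumes \<phi>: "metric_integrand \<phi>" and \<nu>: "\<And>\<xi>. \<nu> \<bullet> \<xi> \<le> \<phi> \<xi>"
    and "\<nu> \<bullet> a = \<phi> a" "\<nu> \<bullet> b = \<phi> b" "0 \<le> s" "0 \<le> t"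
  shows "\<phi> (s *\<^sub>R a + t *\<^sub>R b) = \<nu> \<bullet> (s *\<^sub>R a + t *\<^sub>R b)"
proof (rule antisym)
  have hom: "\<phi> (t *\<^sub>R \<xi>) = \<bar>t\<bar> * \<phi> \<xi>" for t \<xi>
    using \<phi> by (auto simp: metric_integrand_def)
  have "\<phi> ((1/2) *\<^sub>R (2 * s) *\<^sub>R a + (1/2) *\<^sub>R (2 * t) *\<^sub>R b) \<le> (1/2) * \<phi> ((2 * s) *\<^sub>R a) + (1/2) * \<phi> ((2 * t) *\<^sub>R b)"
    using \<phi> convex_onD[of UNIV \<phi> "1/2" "(2 * s) *\<^sub>R a" "(2 * t) *\<^sub>R b"]
    by (simp add: metric_integrand_def)
  then have "\<phi> (s *\<^sub>R a + t *\<^sub>R b) \<le> s * \<phi> a + t * \<phi> b"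
    using assms(5,6) by (simp add: hom)
  then show "\<phi> (s *\<^sub>R a + t *\<^sub>R b) \<le> \<nu> \<bullet> (s *\<^sub>R a + t *\<^sub>R b)"
    using assms(3,4) by (simp add: inner_add_right)
qed (rule \<nu>)

text \<open>
  Let \<open>\<nu>\<close> support the unit ball at the midpoint \<open>m\<close> of a segment \<open>[a, b]\<close> in its boundary. The
  values of \<open>\<nu>\<close> at \<open>a\<close> and \<open>b\<close> are at most \<open>1\<close> with mean \<open>1\<close>, so both are \<open>1\<close>, and \<open>\<phi>\<close>
  agrees with \<open>\<nu>\<close> on the cone spanned by \<open>a\<close> and \<open>b\<close>. In the plane this cone is a neighbourhood
  of \<open>m\<close>: the vectors \<open>a\<close> and \<open>b\<close> are independent, because proportional vectors with the same
  value under \<open>\<nu>\<close> are equal.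
\<close>

lemma calibrated_ball_of_flat_segment:
  fixes \<phi> :: "real^2 \<Rightarrow> real"
  assumes \<phi>: "metric_integrand \<phi>" and "\<not> strictly_convex_body (integrand_ball \<phi>)"
  obtains \<nu> m \<delta> where "\<And>\<xi>. \<nu> \<bullet> \<xi> \<le> \<phi> \<xi>" "\<delta> > 0" "\<And>\<xi>. \<xi> \<in> ball m \<delta> \<Longrightarrow> \<phi> \<xi> = \<nu> \<bullet> \<xi>"
proof -
  obtain a b where ab: "a \<noteq> b" "closed_segment a b \<subseteq> frontier (integrand_ball \<phi>)"
    using assms(2) by (auto simp: strictly_convex_body_def)
  have hom: "\<phi> (t *\<^sub>R \<xi>) = \<bar>t\<bar> * \<phi> \<xi>" for t \<xi>
    using \<phi> by (auto simp: metric_integrand_def)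
  define m where "m = midpoint a b"
  have m: "m \<in> frontier (integrand_ball \<phi>)"
    using ab(2) by (auto simp: m_def)
  have one: "\<phi> a = 1" "\<phi> b = 1" "\<phi> m = 1"
    using metric_integrand_frontier_ball[OF \<phi>] ab(2) m by auto
  obtain \<nu> where \<nu>: "\<nu> \<bullet> m = 1" "\<And>\<xi>. \<nu> \<bullet> \<xi> \<le> \<phi> \<xi>"
    using supporting_functional[OF \<phi> m] by blast
  have "\<nu> \<bullet> a + \<nu> \<bullet> b = 2"
    using \<nu>(1) by (simp add: m_def midpoint_def inner_add_right)
  then have \<nu>ab: "\<nu> \<bullet> a = \<phi> a" "\<nu> \<bullet> b = \<phi> b"
    using \<nu>(2)[of a] \<nu>(2)[of b] one by linarith+
  define d where "d = a$1 * b$2 - a$2 * b$1"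
  have d: "d \<noteq> 0"
  proof
    assume d0: "d = 0"
    have "b$1 *\<^sub>R a = a$1 *\<^sub>R b" "b$2 *\<^sub>R a = a$2 *\<^sub>R b"
      using d0 by (auto simp: d_def vec_eq_iff forall_2 mult.commute)
    then have "b$1 * (\<nu> \<bullet> a) = a$1 * (\<nu> \<bullet> b)" "b$2 * (\<nu> \<bullet> a) = a$2 * (\<nu> \<bullet> b)"
      by (metis inner_scaleR_right)+
    then have "a = b"
      using \<nu>ab one by (simp add: vec_eq_iff forall_2)
    then show False using ab(1) by blast
  qed
  \<comment> \<open>coordinates with respect to the basis \<open>a\<close>, \<open>b\<close>, by Cramer's rule\<close>
  define s where "s \<xi> = (\<xi>$1 * b$2 - \<xi>$2 * b$1) / d" for \<xi> :: "real^2"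
  define t where "t \<xi> = (a$1 * \<xi>$2 - a$2 * \<xi>$1) / d" for \<xi> :: "real^2"
  have rep: "\<xi> = s \<xi> *\<^sub>R a + t \<xi> *\<^sub>R b" for \<xi>
  proof -
    have comb: "p / d * x + q / d * y = (p * x + q * y) / d" for p q x y
      by (simp add: add_divide_distrib)
    have "(\<xi>$1 * b$2 - \<xi>$2 * b$1) * a$1 + (a$1 * \<xi>$2 - a$2 * \<xi>$1) * b$1 = \<xi>$1 * d"
      "(\<xi>$1 * b$2 - \<xi>$2 * b$1) * a$2 + (a$1 * \<xi>$2 - a$2 * \<xi>$1) * b$2 = \<xi>$2 * d"
      by (simp_all add: d_def algebra_simps)
    then show ?thesis
      using d by (simp only: s_def t_def vec_eq_iff forall_2 vector_add_component
          vector_scaleR_component real_scaleR_def comb) simp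
  qed
  have "open ({\<xi>. 0 < s \<xi>} \<inter> {\<xi>. 0 < t \<xi>})"
    unfolding s_def t_def using d by (intro open_Int open_Collect_less continuous_intros) auto
  moreover have "m$1 * b$2 - m$2 * b$1 = d / 2" "a$1 * m$2 - a$2 * m$1 = d / 2"
    by (simp_all add: d_def m_def midpoint_def algebra_simps)
  then have "s m = 1 / 2" "t m = 1 / 2"
    using d by (simp_all only: s_def t_def) simp_all
  then have "m \<in> {\<xi>. 0 < s \<xi>} \<inter> {\<xi>. 0 < t \<xi>}"
    by simp
  ultimately obtain \<delta> where \<delta>: "\<delta> > 0" "ball m \<delta> \<subseteq> {\<xi>. 0 < s \<xi>} \<inter> {\<xi>. 0 < t \<xi>}"
    by (meson open_contains_ball)
  have "\<phi> \<xi> = \<nu> \<bullet> \<xi>" if "\<xi> \<in> ball m \<delta>" for \<xi>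
  proof -
    have "0 < s \<xi>" "0 < t \<xi>"
      using \<delta>(2) that by auto
    then show ?thesis
      using linear_on_cone[OF \<phi> \<nu>(2) \<nu>ab, of "s \<xi>" "t \<xi>"] by (metis rep less_imp_le)
  qed
  then show ?thesis
    using \<nu>(2) \<delta>(1) that by blast
qed

section \<open>Traces and smooth data on the circle\<close>

lemma has_trace_on_circle_continuous:
  assumes u: "continuous_on UNIV u" and f: "\<And>x. norm x = 1 \<Longrightarrow> f x = u x"
  shows "has_trace_on_circle u f"
proof -
  have "norm (circle_point \<theta>) = 1" for \<theta>
    by (simp add: circle_point_def norm_vec_def L2_set_def UNIV_2)
  moreover have "{x::real^2. norm x = 1} \<in> sets borel"
    by (intro borel_closed closed_Collect_eq continuous_intros)
  ultimately have "AE x in circle_measure. norm x = 1"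
    unfolding circle_measure_def by (subst AE_distr_iff[OF circle_point_measurable]) auto
  then show ?thesis
    unfolding has_trace_on_circle_def
  proof eventually_elim
    case (elim x)
    let ?A = "\<lambda>r. unit_disc \<inter> ball x r"
    let ?q = "\<lambda>r. (\<integral>y. \<bar>u y - f x\<bar> \<partial>lebesgue_on (?A r)) / measure lebesgue (?A r)"
    show "(?q \<longlongrightarrow> 0) (at_right 0)"
    proof (rule tendstoI)
      fix e :: real assume e: "e > 0"
      obtain d where d: "d > 0" "\<And>y. dist y x < d \<Longrightarrow> \<bar>u y - u x\<bar> < e / 2"
        using u e unfolding continuous_on_iff dist_real_def by (metis UNIV_I half_gt_zero)
      have "dist (?q r) 0 < e" if r: "r < d" for r
      proof -
        have A: "?A r \<in> lmeasurable"
          by (intro fmeasurable.Int lmeasurable_ball)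
        interpret finite_measure "lebesgue_on (?A r)"
          by (rule finite_measure_lebesgue_on[OF A])
        have "(\<integral>y. \<bar>u y - f x\<bar> \<partial>lebesgue_on (?A r)) \<le> (\<integral>y. e / 2 \<partial>lebesgue_on (?A r))"
        proof (rule integral_mono')
          show "\<bar>u y - f x\<bar> \<le> e / 2" if "y \<in> space (lebesgue_on (?A r))" for y
            using that d(2)[of y] r f[OF elim] by (simp add: dist_commute)
        qed (use e in auto)
        also have "\<dots> = e / 2 * measure lebesgue (?A r)"
          using A by (simp add: measure_restrict_space fmeasurableD mult.commute)
        finally have "?q r \<le> e / 2"
          using e by (cases "measure lebesgue (?A r) = 0") (simp_all add: divide_le_eq zero_less_measure_iff)
        moreover have "0 \<le> ?q r"
          by simp
        ultimately have "dist (?q r) 0 \<le> e / 2"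
          by (simp only: dist_real_def abs_of_nonneg diff_zero)
        then show ?thesis
          using e by linarith
      qed
      then show "\<forall>\<^sub>F r in at_right 0. dist (?q r) 0 < e"
        using d(1) eventually_at_right_less[of 0] by (auto simp: eventually_at_right_field)
    qed
  qed
qed

lemma smooth_on_circle_inner:
  "smooth_on_circle (\<lambda>x. m \<bullet> x)"
proof -
  have D: "((\<lambda>t. A * cos t + B * sin t) has_real_derivative B * cos t + (- A) * sin t) (at t)" for A B t :: real
    by (auto intro!: derivative_eq_intros)
  have "\<exists>A B. (deriv ^^ n) (\<lambda>t. m \<bullet> circle_point t) = (\<lambda>t. A * cos t + B * sin t)" for n
  proof (induction n)
    case 0
    then show ?case
      by (auto simp: circle_point_def inner_vec_def UNIV_2)
  next
    case (Suc n)
    then obtain A B where "(deriv ^^ n) (\<lambda>t. m \<bullet> circle_point t) = (\<lambda>t. A * cos t + B * sin t)"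
      by blast
    then have "(deriv ^^ Suc n) (\<lambda>t. m \<bullet> circle_point t) = (\<lambda>t. B * cos t + (- A) * sin t)"
      using DERIV_imp_deriv[OF D] by (auto intro!: ext)
    then show ?case by blast
  qed
  then show ?thesis
    unfolding smooth_on_circle_def by (metis D field_differentiable_def)
qed

section \<open>A family of solutions with the same boundary data\<close>

text \<open>
  On the unit disc the gradient \<open>m - 2 \<epsilon> x\<close> stays within distance \<open>2 \<epsilon> < \<delta>\<close> of \<open>m\<close>, where \<open>\<nu>\<close>
  calibrates; on the unit circle the perturbation \<open>\<epsilon> (1 - \<bar>x\<bar>\<^sup>2)\<close> vanishes.
\<close>

lemma paraboloid_least_gradient_solution:
  fixes \<phi> :: "real^2 \<Rightarrow> real"
  assumes \<phi>: "metric_integrand \<phi>" and \<nu>: "\<And>\<xi>. \<nu> \<bullet> \<xi> \<le> \<phi> \<xi>"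
    and lin: "\<And>\<xi>. \<xi> \<in> ball m \<delta> \<Longrightarrow> \<phi> \<xi> = \<nu> \<bullet> \<xi>"
    and \<epsilon>: "0 \<le> \<epsilon>" "2 * \<epsilon> < \<delta>"
  shows "least_gradient_solution \<phi> (\<lambda>x. m \<bullet> x) (\<lambda>x. m \<bullet> x + \<epsilon> * (1 - x \<bullet> x))"
proof -
  let ?u = "\<lambda>x. m \<bullet> x + \<epsilon> * (1 - x \<bullet> x)" and ?g = "\<lambda>x. m - (2 * \<epsilon>) *\<^sub>R x"
  have grad: "C1_gradient_on UNIV ?u ?g"
    unfolding C1_gradient_on_def
  proof (intro conjI ballI)
    show "(?u has_derivative (\<lambda>h. ?g x \<bullet> h)) (at x)" for x
      by (rule derivative_eq_intros refl)+
         (simp add: fun_eq_iff inner_diff_left inner_commute[of _ x])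
    show "continuous_on UNIV ?g"
      by (intro continuous_intros)
  qed
  then have grad': "C1_gradient_on unit_disc ?u ?g"
    by (auto simp: C1_gradient_on_def intro: continuous_on_subset)
  have int: "integrable (lebesgue_on unit_disc) F" if "continuous_on UNIV F" for F :: "real^2 \<Rightarrow> real"
  proof -
    have "integrable lborel (\<lambda>x. indicator (cball 0 1) x *\<^sub>R F x)"
      using that by (intro borel_integrable_compact) (auto intro: continuous_on_subset)
    then have "set_integrable lebesgue (cball 0 1) F"
      by (simp add: set_integrable_def integrable_completion)
    then have "set_integrable lebesgue unit_disc F"
      by (rule set_integrable_subset) auto
    then show ?thesis
      by (simp add: set_integrable_def integrable_restrict_space)
  qed
  have "?u \<in> BV unit_disc"
    by (rule C1_gradient_on_in_BV[OF open_ball grad']) (intro int continuous_intros)+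
  moreover have "\<phi> (?g x) = \<nu> \<bullet> ?g x" if "x \<in> unit_disc" for x
  proof (rule lin)
    have "2 * \<epsilon> * norm x \<le> 2 * \<epsilon>"
      using that \<epsilon>(1) by (intro mult_left_le) auto
    then show "?g x \<in> ball m \<delta>"
      using \<epsilon> by (simp add: dist_norm)
  qed
  ultimately have "least_gradient \<phi> unit_disc ?u"
    by (rule least_gradient_if_calibrated[OF \<phi> grad' _ \<nu>])
  moreover have "has_trace_on_circle ?u (\<lambda>x. m \<bullet> x)"
  proof (rule has_trace_on_circle_continuous)
    show "continuous_on UNIV ?u"
      by (rule C1_gradient_on_imp_continuous_on[OF grad])
  qed (simp add: dot_square_norm)
  ultimately show ?thesis
    by (simp add: least_gradient_solution_def)
qed

theorem proposition5p6:
  fixes \<phi> :: "real^2 \<Rightarrow> real"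
  assumes "metric_integrand \<phi>"
    and "\<not> strictly_convex_body (integrand_ball \<phi>)"
  shows "\<exists>f. smooth_on_circle f \<and>
           (\<exists>u1 u2. least_gradient_solution \<phi> f u1 \<and> least_gradient_solution \<phi> f u2 \<and>
              \<not> (AE x in lebesgue_on unit_disc. u1 x = u2 x))"
proof (rule calibrated_ball_of_flat_segment[OF assms])
  fix \<nu> m :: "real^2" and \<delta> :: real
  assume \<nu>: "\<And>\<xi>. \<nu> \<bullet> \<xi> \<le> \<phi> \<xi>" and \<delta>: "\<delta> > 0"
    and lin: "\<And>\<xi>. \<xi> \<in> ball m \<delta> \<Longrightarrow> \<phi> \<xi> = \<nu> \<bullet> \<xi>"
  let ?u = "\<lambda>\<epsilon> x. m \<bullet> x + \<epsilon> * (1 - x \<bullet> x)"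
  have solution: "least_gradient_solution \<phi> (\<lambda>x. m \<bullet> x) (?u \<epsilon>)" if "0 \<le> \<epsilon>" "2 * \<epsilon> < \<delta>" for \<epsilon>
    using assms(1) \<nu> lin that by (rule paraboloid_least_gradient_solution)
  have "\<not> (AE x in lebesgue_on unit_disc. ?u 0 x = ?u (\<delta> / 4) x)"
  proof
    assume "AE x in lebesgue_on unit_disc. ?u 0 x = ?u (\<delta> / 4) x"
    then have "AE x in lebesgue_on unit_disc. False"
      using AE_space
    proof eventually_elim
      case (elim x)
      then have "x \<bullet> x < 1"
        by (simp add: dot_square_norm power_less_one_iff)
      then show ?case
        using elim(1) \<delta> by simp
    qed
    then have "emeasure (lebesgue_on unit_disc) (space (lebesgue_on unit_disc)) = 0"
      by (subst (asm) AE_iff_measurable[OF sets.top]) auto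
    then have "measure lebesgue unit_disc = 0"
      by (simp add: emeasure_restrict_space measure_def)
    then show False
      using content_ball_pos[of 1 "0 :: real^2"] by simp
  qed
  moreover have "least_gradient_solution \<phi> (\<lambda>x. m \<bullet> x) (?u 0)"
    using \<delta> by (intro solution) simp_all
  moreover have "least_gradient_solution \<phi> (\<lambda>x. m \<bullet> x) (?u (\<delta> / 4))"
    using \<delta> by (intro solution) simp_all
  ultimately show ?thesis
    using smooth_on_circle_inner[of m] by (intro exI conjI)
qed

end
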